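(* If a graph $G$ (undirected, loops allowed) has no nontrivial even closed walk, then $$|E(G)|\le |V(G)|.$$
   Context: A graph $G$ consists of a set $V=V(G)$ of vertices and a set $E=E(G)$ of edges, where $E(G)$ is a subset of $\{\{u,v\}\mid u,v\in V\}$. Loops are allowed (i.e. $\{v,v\}\in E(G)$ is permitted), and $G$ is undirected; since $E(G)$ is a set, there are no multiple edges. A nontrivial closed walk is an alternating sequence of vertices and edges $v_1,e_1,v_2,\dots,v_{n-1},e_{n-1},v_n,e_n,v_1$ (so $e_i=\{v_i,v_{i+1}\}\in E(G)$ for $1\le i\le n$, with $v_{n+1}=v_1$; vertices may repeat; $n=1$ is allowed) such that at least one edge appears exactly once among $e_1,\dots,e_n$ and each edge appears at most two times among $e_1,\dots,e_n$. If $n$ is even, it is called a nontrivial even closed walk. *)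

theory Defs
  imports "HOL-Library.Equipollence"
begin

text \<open>Undirected graphs without multiple edges, with loops allowed: since \<open>{v, v} = {v}\<close>,
  a loop at \<open>v\<close> is the singleton \<open>{v}\<close>. No finiteness is assumed.\<close>

definition loop_graph :: "'a set \<Rightarrow> 'a set set \<Rightarrow> bool" where
  "loop_graph V E \<longleftrightarrow> E \<subseteq> {{u, v} | u v. u \<in> V \<and> v \<in> V}"

text \<open>The closed walk \<open>v\<^sub>1, e\<^sub>1, v\<^sub>2, \<dots>, v\<^sub>n, e\<^sub>n, v\<^sub>1\<close> is given by its lists
  \<open>vs = [v\<^sub>1, \<dots>, v\<^sub>n]\<close> and \<open>es = [e\<^sub>1, \<dots>, e\<^sub>n]\<close>; the repeated final vertex \<open>v\<^sub>1\<close>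
  is not listed, so that \<open>n\<close> is the common length. List indices start at 0.\<close>

definition closed_walk :: "'a set \<Rightarrow> 'a set set \<Rightarrow> 'a list \<Rightarrow> 'a set list \<Rightarrow> bool" where
  "closed_walk V E vs es \<longleftrightarrow>
     es \<noteq> [] \<and> length vs = length es \<and> set vs \<subseteq> V \<and> set es \<subseteq> E \<and>
     (\<forall>i < length es. es ! i = {vs ! i, vs ! (Suc i mod length es)})"

definition nontrivial_closed_walk :: "'a set \<Rightarrow> 'a set set \<Rightarrow> 'a list \<Rightarrow> 'a set list \<Rightarrow> bool" where
  "nontrivial_closed_walk V E vs es \<longleftrightarrow>
     closed_walk V E vs es \<and>
     (\<exists>e. count_list es e = 1) \<and> (\<forall>e. count_list es e \<le> 2)"

definition nontrivial_even_closed_walk :: "'a set \<Rightarrow> 'a set set \<Rightarrow> 'a list \<Rightarrow> 'a set list \<Rightarrow> bool" where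
  "nontrivial_even_closed_walk V E vs es \<longleftrightarrow>
     nontrivial_closed_walk V E vs es \<and> even (length es)"

end

theory Submission
  imports Defs
begin

text \<open>For finite \<open>V\<close>, insert the edges one at a time. Every component is kept either bipartite,
  any two of its vertices being joined by a trail, or odd, any two of its vertices being joined by
  walks of both parities that use each edge at most twice. Without a nontrivial even closed walk, a
  new edge never lies inside an odd component or between two odd ones, and in the remaining cases it
  lowers the number of bipartite components by one. Hence the number of edges is the number of
  vertices minus the number of bipartite components. For infinite \<open>V\<close> there are at most
  \<open>|V \<times> V| = |V|\<close> edges.\<close>

section \<open>Walks as edge lists, and closed walks\<close>

fun walk :: "'a set set \<Rightarrow> 'a \<Rightarrow> 'a set list \<Rightarrow> 'a \<Rightarrow> bool" where
  "walk F u [] v \<longleftrightarrow> u = v"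
| "walk F u (e # es) v \<longleftrightarrow> e \<in> F \<and> (\<exists>w. e = {u, w} \<and> walk F w es v)"

lemma walk_append:
  "walk F u (es @ fs) w \<longleftrightarrow> (\<exists>v. walk F u es v \<and> walk F v fs w)"
  by (induction es arbitrary: u) auto

lemma walk_mono: "walk F u es v \<Longrightarrow> F \<subseteq> G \<Longrightarrow> walk G u es v"
  by (induction es arbitrary: u) auto

lemma walk_edges: "walk F u es v \<Longrightarrow> set es \<subseteq> F"
  by (induction es arbitrary: u) auto

text \<open>\<open>vs\<close> omits the final vertex, as in \<open>closed_walk\<close>; appending
  \<open>v\<close> lets one formula cover both the last edge and the empty walk, for which it says
  \<open>u = v\<close>.\<close>

lemma walk_vertices:
  assumes "walk F u es v" "\<Union>F \<subseteq> V"
  shows "\<exists>vs. length vs = length es \<and> set vs \<subseteq> V \<and> (vs @ [v]) ! 0 = u \<and>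
           (\<forall>i < length es. es ! i = {vs ! i, (vs @ [v]) ! Suc i})"
  using assms(1)
proof (induction es arbitrary: u)
  case Nil
  then show ?case by simp
next
  case (Cons e es)
  from Cons.prems obtain w where w: "e \<in> F" "e = {u, w}" "walk F w es v" by auto
  from Cons.IH[OF w(3)] obtain vs where vs: "length vs = length es" "set vs \<subseteq> V"
    "(vs @ [v]) ! 0 = w" "\<forall>i < length es. es ! i = {vs ! i, (vs @ [v]) ! Suc i}" by blast
  have "u \<in> V" using w assms(2) by auto
  moreover have "(e # es) ! i = {(u # vs) ! i, ((u # vs) @ [v]) ! Suc i}"
    if "i < length (e # es)" for i
    using that vs(3,4) w(2) by (cases i) auto
  ultimately show ?case using vs(1,2) by (intro exI[of _ "u # vs"]) simp
qed

lemma closed_walk_of_walk: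
  assumes "walk E u es u" "\<Union>E \<subseteq> V" "es \<noteq> []"
  shows "\<exists>vs. closed_walk V E vs es"
proof -
  obtain vs where vs: "length vs = length es" "set vs \<subseteq> V" "(vs @ [u]) ! 0 = u"
    "\<forall>i < length es. es ! i = {vs ! i, (vs @ [u]) ! Suc i}"
    using walk_vertices[OF assms(1,2)] by blast
  have "vs ! 0 = u" using vs(1,3) assms(3) by (simp add: nth_append)
  \<comment> \<open>At the last edge \<open>Suc i mod length es\<close> wraps around to 0, and
    \<open>vs ! 0\<close> is the appended vertex \<open>u\<close>.\<close>
  hence "(vs @ [u]) ! Suc i = vs ! (Suc i mod length es)" if "i < length es" for i
    using that vs(1) by (cases "Suc i = length es") (auto simp: nth_append)
  hence "closed_walk V E vs es"
    using vs assms(3) walk_edges[OF assms(1)] by (simp add: closed_walk_def)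
  thus ?thesis ..
qed

section \<open>Parity and nontrivial even closed walks\<close>

lemma odd_length_count_one:
  assumes "odd (length xs)" "\<forall>x. count_list xs x \<le> 2"
  shows "\<exists>x. count_list xs x = 1"
proof (rule ccontr)
  assume none: "\<nexists>x. count_list xs x = 1"
  \<comment> \<open>Multiplicities are at most 2 and never 1, so all are even, and so is their sum,
    the length.\<close>
  have "even (count_list xs x)" for x
  proof -
    have "count_list xs x \<in> {0, 2}" using none assms(2)
      by (metis One_nat_def insertCI le_SucE le_zero_eq numeral_2_eq_2)
    thus ?thesis by auto
  qed
  hence "even (\<Sum>x\<in>set xs. count_list xs x)" by (intro dvd_sum) simp
  thus False using assms(1) sum_count_set[of xs "set xs"] by simp
qed

text \<open>Phrased with \<open>walk\<close>, the condition does not involve the vertex set and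
  passes to subsets of the edges, which the induction on edges needs.\<close>

definition even_walk_free :: "'a set set \<Rightarrow> bool" where
  "even_walk_free E \<longleftrightarrow>
     (\<forall>u es. walk E u es u \<longrightarrow> even (length es) \<longrightarrow> (\<forall>f. count_list es f \<le> 2) \<longrightarrow>
        (\<nexists>f. count_list es f = 1))"

lemma even_walk_freeD:
  assumes "even_walk_free E" "walk E u es u" "even (length es)"
    "\<And>f. count_list es f \<le> 2" "count_list es e = 1"
  shows False
  using assms unfolding even_walk_free_def by blast

lemma even_walk_free_mono: "even_walk_free E \<Longrightarrow> F \<subseteq> E \<Longrightarrow> even_walk_free F"
  unfolding even_walk_free_def by (meson walk_mono)

lemma even_walk_free_if_no_even_closed_walk:
  assumes "loop_graph V E" "\<nexists>vs es. nontrivial_even_closed_walk V E vs es"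
  shows "even_walk_free E"
  unfolding even_walk_free_def
proof (intro allI impI notI)
  fix u es
  assume w: "walk E u es u" "even (length es)" "\<forall>f. count_list es f \<le> 2"
    and one: "\<exists>f. count_list es f = 1"
  have "\<Union>E \<subseteq> V" using assms(1) by (auto simp: loop_graph_def)
  moreover have "es \<noteq> []" using one by auto
  ultimately obtain vs where "closed_walk V E vs es" using closed_walk_of_walk[OF w(1)] by blast
  thus False using assms(2) w one
    by (auto simp: nontrivial_even_closed_walk_def nontrivial_closed_walk_def)
qed

section \<open>Walks of given parity and bounded edge multiplicity\<close>

definition reach :: "nat \<Rightarrow> 'a set set \<Rightarrow> 'a \<Rightarrow> bool \<Rightarrow> 'a \<Rightarrow> bool" where
  "reach k F u p v \<longleftrightarrow>
     (\<exists>es. walk F u es v \<and> (\<forall>f. count_list es f \<le> k) \<and> (odd (length es) \<longleftrightarrow> p))"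

lemma reach_mono: "reach k F u p v \<Longrightarrow> F \<subseteq> G \<Longrightarrow> k \<le> l \<Longrightarrow> reach l G u p v"
  unfolding reach_def by (meson walk_mono le_trans)

lemma reach_walk:
  assumes "reach k F u p v"
  shows "\<exists>es. walk F u es v \<and> (\<forall>f. count_list es f \<le> k) \<and> (odd (length es) \<longleftrightarrow> p) \<and>
           (\<forall>f. f \<notin> F \<longrightarrow> count_list es f = 0)"
proof -
  obtain es where es: "walk F u es v" "\<forall>f. count_list es f \<le> k" "odd (length es) \<longleftrightarrow> p"
    using assms unfolding reach_def by blast
  moreover have "count_list es f = 0" if "f \<notin> F" for f
    using walk_edges[OF es(1)] that by (meson count_list_0_iff in_mono)
  ultimately show ?thesis by blast
qed

text \<open>Concatenation through a new edge \<open>{v, w}\<close>, used once. Multiplicities of the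
  two walks add, unless their edge sets are disjoint; the new edge contributes the extra parity flip
  in \<open>r\<close>.\<close>

lemma reach_join:
  assumes "reach k F u p v" "reach l G w q x" "{v, w} \<notin> F" "{v, w} \<notin> G" "1 \<le> m"
    and "k + l \<le> m \<or> F \<inter> G = {} \<and> k \<le> m \<and> l \<le> m"
    and "insert {v, w} (F \<union> G) \<subseteq> H" "r \<longleftrightarrow> (p \<longleftrightarrow> q)"
  shows "reach m H u r x"
proof -
  obtain es where es: "walk F u es v" "\<And>f. count_list es f \<le> k" "odd (length es) \<longleftrightarrow> p"
    "\<And>f. f \<notin> F \<Longrightarrow> count_list es f = 0" using reach_walk[OF assms(1)] by blast
  obtain fs where fs: "walk G w fs x" "\<And>f. count_list fs f \<le> l" "odd (length fs) \<longleftrightarrow> q"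
    "\<And>f. f \<notin> G \<Longrightarrow> count_list fs f = 0" using reach_walk[OF assms(2)] by blast
  have "walk H u es v" "walk H w fs x"
    using walk_mono[OF es(1)] walk_mono[OF fs(1)] assms(7) by auto
  hence "walk H u (es @ {v, w} # fs) x"
    using assms(7) by (auto simp: walk_append)
  moreover have "count_list (es @ {v, w} # fs) f \<le> m" for f
  proof (cases "f = {v, w}")
    case True
    thus ?thesis using es(4)[of f] fs(4)[of f] assms(3,4,5) by simp
  next
    case False
    hence "count_list (es @ {v, w} # fs) f = count_list es f + count_list fs f" by auto
    moreover have "f \<notin> F \<or> f \<notin> G \<or> k + l \<le> m" using assms(6) by auto
    ultimately show ?thesis using es(2)[of f] fs(2)[of f] es(4)[of f] fs(4)[of f] assms(6) by auto
  qed
  moreover have "odd (length (es @ {v, w} # fs)) \<longleftrightarrow> r" using es(3) fs(3) assms(8) by auto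
  ultimately show ?thesis unfolding reach_def by blast
qed

text \<open>Interrupt a walk in \<open>F\<close> at \<open>v\<close>: cross to \<open>w\<close>, run
  a closed walk in \<open>G\<close>, cross back. The two crossings cancel in parity, so the closed
  walk alone decides by how much the parity changes, and no edge is used more than twice.\<close>

lemma reach_detour:
  assumes "reach 1 F u p v" "reach 2 G w q w" "reach 1 F v r x"
    and "{v, w} \<notin> F" "{v, w} \<notin> G" "F \<inter> G = {}"
    and "insert {v, w} (F \<union> G) \<subseteq> H" "s \<longleftrightarrow> (p \<longleftrightarrow> (q \<longleftrightarrow> r))"
  shows "reach 2 H u s x"
proof -
  let ?e = "{v, w}"
  obtain es where es: "walk F u es v" "\<And>f. count_list es f \<le> 1" "odd (length es) \<longleftrightarrow> p"
    "\<And>f. f \<notin> F \<Longrightarrow> count_list es f = 0" using reach_walk[OF assms(1)] by blast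
  obtain fs where fs: "walk G w fs w" "\<And>f. count_list fs f \<le> 2" "odd (length fs) \<longleftrightarrow> q"
    "\<And>f. f \<notin> G \<Longrightarrow> count_list fs f = 0" using reach_walk[OF assms(2)] by blast
  obtain gs where gs: "walk F v gs x" "\<And>f. count_list gs f \<le> 1" "odd (length gs) \<longleftrightarrow> r"
    "\<And>f. f \<notin> F \<Longrightarrow> count_list gs f = 0" using reach_walk[OF assms(3)] by blast
  let ?ws = "es @ ?e # fs @ ?e # gs"
  have "walk H u es v" "walk H w fs w" "walk H v gs x" "?e \<in> H" "?e = {w, v}"
    using walk_mono[OF es(1)] walk_mono[OF fs(1)] walk_mono[OF gs(1)] assms(7) by auto
  hence "walk H u ?ws x" unfolding walk_append walk.simps by blast
  moreover have "count_list ?ws f \<le> 2" for f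
  proof (cases "f = ?e")
    case True
    thus ?thesis using es(4)[of f] fs(4)[of f] gs(4)[of f] assms(4,5) by simp
  next
    case False
    hence eq: "count_list ?ws f = count_list es f + count_list fs f + count_list gs f" by auto
    show ?thesis
    proof (cases "f \<in> F")
      case True
      hence "count_list fs f = 0" using fs(4) assms(6) by auto
      thus ?thesis using eq es(2)[of f] gs(2)[of f] by simp
    next
      case False
      thus ?thesis using eq es(4)[of f] gs(4)[of f] fs(2)[of f] by simp
    qed
  qed
  moreover have "odd (length ?ws) \<longleftrightarrow> s" using es(3) fs(3) gs(3) assms(8) by auto
  ultimately show ?thesis unfolding reach_def by blast
qed

section \<open>Edges whose insertion creates a nontrivial even closed walk\<close>

lemma no_odd_reach_across_edge:
  assumes "even_walk_free (insert {a, b} E)" "{a, b} \<notin> E" "F \<subseteq> E" "k \<le> 2"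
  shows "\<not> reach k F b True a"
proof
  assume r: "reach k F b True a"
  obtain es where es: "walk F b es a" "\<And>f. count_list es f \<le> k" "odd (length es)"
    "\<And>f. f \<notin> F \<Longrightarrow> count_list es f = 0" using reach_walk[OF r] unfolding simp_thms by blast
  have z: "count_list es {a, b} = 0" using es(4) assms(2,3) by blast
  have "walk (insert {a, b} E) b es a" using walk_mono[OF es(1)] assms(3) by blast
  \<comment> \<open>Closing the odd walk with the new edge gives an even closed walk in which that
    edge occurs exactly once.\<close>
  hence "walk (insert {a, b} E) a ({a, b} # es) a" by auto
  moreover have "even (length ({a, b} # es))" using es(3) by simp
  moreover have "count_list ({a, b} # es) f \<le> 2" for f
    using z es(2)[of f] assms(4) by auto
  moreover have "count_list ({a, b} # es) {a, b} = 1" using z by simp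
  ultimately show False by (rule even_walk_freeD[OF assms(1)])
qed

text \<open>Two odd closed walks in disjoint edge sets, linked by traversing the new edge back and
  forth, form an even closed walk.\<close>

lemma not_both_odd:
  assumes free: "even_walk_free (insert {a, b} E)" and e: "{a, b} \<notin> E"
    and "F \<subseteq> E" "G \<subseteq> E" "F \<inter> G = {}" "reach 2 F a True a" "reach 2 G b True b"
  shows False
proof -
  let ?e = "{a, b}" and ?H = "insert {a, b} E"
  obtain es where es: "walk F a es a" "\<And>f. count_list es f \<le> 2" "odd (length es)"
    "\<And>f. f \<notin> F \<Longrightarrow> count_list es f = 0" using reach_walk[OF assms(6)] unfolding simp_thms by blast
  obtain fs where fs: "walk G b fs b" "\<And>f. count_list fs f \<le> 2" "odd (length fs)"
    "\<And>f. f \<notin> G \<Longrightarrow> count_list fs f = 0" using reach_walk[OF assms(7)] unfolding simp_thms by blast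
  let ?ws = "es @ ?e # fs @ [?e]"
  have ze: "count_list es ?e = 0" "count_list fs ?e = 0" using es(4) fs(4) assms(2-4) by blast+
  \<comment> \<open>The new edge occurs twice, so an edge of multiplicity one is taken from the odd
    walk \<open>es\<close>; it lies in \<open>F\<close> and hence not in \<open>fs\<close>.\<close>
  obtain f where f: "count_list es f = 1"
    using odd_length_count_one[OF es(3)] es(2) by blast
  have ne: "f \<noteq> ?e" using f ze by auto
  have "f \<in> F" using f es(4) by fastforce
  hence "count_list fs f = 0" using fs(4) assms(5) by blast
  hence one: "count_list ?ws f = 1" using f ne by auto
  have w: "walk ?H b fs b" using walk_mono[OF fs(1) subset_insertI2[OF assms(4)]] .
  have "walk ?H a es a" using walk_mono[OF es(1) subset_insertI2[OF assms(3)]] .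
  moreover have "walk ?H b [?e] a" by (simp add: insert_commute)
  hence "walk ?H b (fs @ [?e]) a" using w walk_append by metis
  hence "walk ?H a (?e # fs @ [?e]) a" by auto
  ultimately have "walk ?H a ?ws a" using walk_append by metis
  moreover have "even (length ?ws)" using es(3) fs(3) by simp
  moreover have "count_list ?ws g \<le> 2" for g
  proof (cases "g = ?e")
    case True
    thus ?thesis using ze by simp
  next
    case False
    hence "count_list ?ws g = count_list es g + count_list fs g" by auto
    moreover have "g \<notin> F \<or> g \<notin> G" using assms(5) by auto
    ultimately show ?thesis using es(2)[of g] es(4)[of g] fs(2)[of g] fs(4)[of g] by auto
  qed
  ultimately show False using one by (rule even_walk_freeD[OF free])
qed

section \<open>Component labellings and insertion of an edge\<close>

definition class_edges :: "'a set set \<Rightarrow> ('a \<Rightarrow> 'b) \<Rightarrow> 'b \<Rightarrow> 'a set set" where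
  "class_edges E r l = {f \<in> E. f \<noteq> {} \<and> (\<forall>x\<in>f. r x = l)}"

text \<open>The map \<open>r\<close> labels the components, \<open>R\<close> is the set of labels of bipartite components, and
  \<open>c\<close> is a proper 2-colouring of these.\<close>

definition component_labelling ::
    "'a set \<Rightarrow> 'a set set \<Rightarrow> ('a \<Rightarrow> 'b) \<Rightarrow> 'b set \<Rightarrow> ('a \<Rightarrow> bool) \<Rightarrow> bool" where
  "component_labelling V E r R c \<longleftrightarrow>
     finite R \<and> card E + card R = card V \<and>
     (\<forall>u\<in>V. \<forall>v\<in>V. r u = r v \<longrightarrow>
        (if r u \<in> R then reach 1 (class_edges E r (r u)) u (c u \<noteq> c v) v
         else \<forall>p. reach 2 (class_edges E r (r u)) u p v))"

text \<open>A nonempty edge determines its label. The empty set would satisfy the label condition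
  vacuously for every label, so \<open>class_edges\<close> excludes it.\<close>

lemma class_edges_disjoint: "l \<noteq> m \<Longrightarrow> class_edges E r l \<inter> class_edges E r m = {}"
  unfolding class_edges_def by fastforce

text \<open>The label of \<open>b\<close> is merged into that of \<open>a\<close>, and exactly one
  label leaves \<open>R\<close>, which balances the new edge in the count. By \<open>ba\<close>, if
  just one end lies in a bipartite component, that end is \<open>a\<close>.\<close>

lemma component_labelling_insert:
  fixes r :: "'a \<Rightarrow> 'b"
  assumes lab: "component_labelling V E r R c"
    and free: "even_walk_free (insert {a, b} E)" and e: "{a, b} \<notin> E"
    and a: "a \<in> V" and b: "b \<in> V" and fin: "finite E"
    and ba: "r b \<in> R \<Longrightarrow> r a \<in> R"
  shows "\<exists>r' R' c'. component_labelling V (insert {a, b} E) (r' :: 'a \<Rightarrow> 'b) R' c'"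
proof -
  let ?e = "{a, b}" and ?A = "r a" and ?B = "r b"
  let ?C = "class_edges E r"
  define r' where "r' x = (if r x = ?B then ?A else r x)" for x
  let ?D = "class_edges (insert ?e E) r'"
  have finR: "finite R" and card: "card E + card R = card V"
    using lab by (auto simp: component_labelling_def)
  have bip: "reach 1 (?C l) u (c u \<noteq> c v) v"
    if "u \<in> V" "v \<in> V" "r u = l" "r v = l" "l \<in> R" for u v l
    using lab that unfolding component_labelling_def by metis
  have odd: "reach 2 (?C l) u p v"
    if "u \<in> V" "v \<in> V" "r u = l" "r v = l" "l \<notin> R" for u v l p
    using lab that unfolding component_labelling_def by metis
  have CE: "?C l \<subseteq> E" for l by (auto simp: class_edges_def)
  have eC: "{a, b} \<notin> ?C l" "{b, a} \<notin> ?C l" for l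
    using e CE[of l] by (auto simp: insert_commute)
  have DAB: "insert {a, b} (?C ?A \<union> ?C ?B) \<subseteq> ?D ?A" "insert {b, a} (?C ?B \<union> ?C ?A) \<subseteq> ?D ?A"
    by (auto simp: class_edges_def r'_def)
  have DA: "?C ?A \<subseteq> ?D ?A" and DB: "?C ?B \<subseteq> ?D ?A" using DAB by auto
  have Dl: "?C l \<subseteq> ?D l" if "l \<noteq> ?B" for l
    using that by (auto simp: class_edges_def r'_def)
  \<comment> \<open>Bookkeeping shared by all cases: \<open>l\<close> is the label removed from
    \<open>R\<close>. Other components keep their walks and relative colours, so only the merged
    component, labelled \<open>?A\<close>, remains to be checked in \<open>AB\<close>.\<close>
  have finish: ?thesis if l: "l \<in> R" and Ac: "\<And>u v. u \<in> V \<Longrightarrow> v \<in> V \<Longrightarrow> r u \<noteq> ?A \<Longrightarrow> r u \<noteq> ?B \<Longrightarrow>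
        r v = r u \<Longrightarrow> (c' u \<noteq> c' v) = (c u \<noteq> c v)" and lAB: "l \<in> {?A, ?B}"
      and AB: "\<And>u v. u \<in> V \<Longrightarrow> v \<in> V \<Longrightarrow> r u \<in> {?A, ?B} \<Longrightarrow> r v \<in> {?A, ?B} \<Longrightarrow>
        if ?A \<in> R - {l} then reach 1 (?D ?A) u (c' u \<noteq> c' v) v else \<forall>p. reach 2 (?D ?A) u p v"
    for l and c' :: "'a \<Rightarrow> bool"
  proof -
    have "card R > 0" using l finR by (auto simp: card_gt_0_iff)
    hence card': "card (insert ?e E) + card (R - {l}) = card V"
      using card finR fin e l by simp
    have joined: "if r' u \<in> R - {l} then reach 1 (?D (r' u)) u (c' u \<noteq> c' v) v
         else \<forall>p. reach 2 (?D (r' u)) u p v"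
      if uv: "u \<in> V" "v \<in> V" "r' u = r' v" for u v
    proof (cases "r u \<in> {?A, ?B}")
      case True
      hence "r' u = ?A" "r v \<in> {?A, ?B}" using uv(3) by (auto simp: r'_def split: if_splits)
      thus ?thesis using AB[OF uv(1,2) True] by metis
    next
      case False
      hence *: "r' u = r u" "r v = r u" "r u \<noteq> l"
        using uv(3) lAB by (auto simp: r'_def split: if_splits)
      have sub: "?C (r u) \<subseteq> ?D (r u)" using Dl[of "r u"] False by auto
      show ?thesis
      proof (cases "r u \<in> R")
        case True
        have "reach 1 (?D (r u)) u (c u \<noteq> c v) v"
          using reach_mono[OF bip[OF uv(1,2) refl *(2) True] sub] by simp
        thus ?thesis using * True False Ac[OF uv(1,2)] by simp
      next
        case False
        have "reach 2 (?D (r u)) u p v" for p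
          using reach_mono[OF odd[OF uv(1,2) refl *(2) False] sub] by simp
        thus ?thesis using * False by simp
      qed
    qed
    have "component_labelling V (insert ?e E) r' (R - {l}) c'"
      unfolding component_labelling_def
      by (intro conjI ballI impI finite_Diff finR card' joined)
    thus ?thesis by blast
  qed
  show ?thesis
  proof (cases "?A = ?B")
    case True
    \<comment> \<open>The edge lies inside one component (loops included). An odd component would
      supply an odd walk from \<open>b\<close> to \<open>a\<close>.\<close>
    have AR: "?A \<in> R"
      using no_odd_reach_across_edge[OF free e CE, of 2] odd[OF b a] True by auto
    \<comment> \<open>Different colours would mean an odd trail from \<open>b\<close> to
      \<open>a\<close>. With equal colours the new edge makes the component odd.\<close>
    have cab: "c a = c b"
    proof (rule ccontr)
      assume "c a \<noteq> c b"
      hence "(c b \<noteq> c a) = True" by auto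
      hence "reach 1 (?C ?A) b True a"
        using bip[OF b a True[symmetric] refl AR] by (simp only:)
      thus False using no_odd_reach_across_edge[OF free e CE, of 1] by simp
    qed
    have "reach 2 (?D ?A) u p v" if uv: "u \<in> V" "v \<in> V" "r u = ?A" "r v = ?A" for u v p
    proof (cases "p \<longleftrightarrow> c u \<noteq> c v")
      case True
      thus ?thesis using reach_mono[OF bip[OF uv AR] DA, of 2] by simp
    next
      case False
      \<comment> \<open>The parity not given by the colours comes from passing through the new edge;
        the two trails may share edges, but each edge is then used at most twice.\<close>
      show ?thesis
        by (rule reach_join[OF bip[OF uv(1) a uv(3) refl AR] bip[OF b uv(2) True[symmetric] uv(4) AR]])
          (use eC DAB cab False True in auto)
    qed
    thus ?thesis using True by (intro finish[OF AR, of c]) auto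
  next
    case ne: False
    \<comment> \<open>Otherwise \<open>ba\<close> puts both ends in odd components, which
      \<open>not_both_odd\<close> forbids.\<close>
    have AR: "?A \<in> R"
      using not_both_odd[OF free e CE CE class_edges_disjoint[OF ne] odd[OF a a refl refl]
          odd[OF b b refl refl]] ba by blast
    have disj: "?C ?A \<inter> ?C ?B = {}" "?C ?B \<inter> ?C ?A = {}"
      using class_edges_disjoint[OF ne, of E] by auto
    show ?thesis
    proof (cases "?B \<in> R")
      case BR: True
      \<comment> \<open>Colours are flipped on the component of \<open>b\<close> exactly when
        \<open>a\<close> and \<open>b\<close> agree, so that the new edge is properly coloured.
        Trails joined across it remain trails since the classes are disjoint.\<close>
      define c' where "c' x = (if r x = ?B \<and> c a = c b then \<not> c x else c x)" for x
      have "reach 1 (?D ?A) u (c' u \<noteq> c' v) v"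
        if uv: "u \<in> V" "v \<in> V" "r u \<in> {?A, ?B}" "r v \<in> {?A, ?B}" for u v
      proof -
        consider "r u = ?A" "r v = ?A" | "r u = ?B" "r v = ?B" | "r u = ?A" "r v = ?B"
          | "r u = ?B" "r v = ?A" using uv(3,4) by auto
        thus ?thesis
        proof cases
          case 1
          thus ?thesis using reach_mono[OF bip[OF uv(1,2) 1 AR] DA, of 1] ne by (simp add: c'_def)
        next
          case 2
          have "(c' u \<noteq> c' v) = (c u \<noteq> c v)" using 2 by (auto simp: c'_def)
          thus ?thesis using reach_mono[OF bip[OF uv(1,2) 2 BR] DB order.refl] by (simp only:)
        next
          case 3
          show ?thesis
            by (rule reach_join[OF bip[OF uv(1) a 3(1) refl AR] bip[OF b uv(2) refl 3(2) BR]])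
              (use eC DAB disj ne 3 in \<open>auto simp: c'_def\<close>)
        next
          case 4
          show ?thesis
            by (rule reach_join[OF bip[OF uv(1) b 4(1) refl BR] bip[OF a uv(2) refl 4(2) AR]])
              (use eC DAB disj ne 4 in \<open>auto simp: c'_def\<close>)
        qed
      qed
      thus ?thesis using ne AR by (intro finish[OF BR, of c']) (auto simp: c'_def)
    next
      case BR: False
      have "reach 2 (?D ?A) u p v"
        if uv: "u \<in> V" "v \<in> V" "r u \<in> {?A, ?B}" "r v \<in> {?A, ?B}" for u v p
      proof -
        consider "r u = ?A" "r v = ?A" | "r u = ?B" "r v = ?B" | "r u = ?A" "r v = ?B"
          | "r u = ?B" "r v = ?A" using uv(3,4) by auto
        thus ?thesis
        proof cases
          case 1
          show ?thesis
            \<comment> \<open>Both vertices lie on the bipartite side: a detour to \<open>b\<close>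
              uses a closed walk there whose parity is chosen to make the total
              \<open>p\<close>.\<close>
            by (rule reach_detour[OF bip[OF uv(1) a 1(1) refl AR]
                  odd[OF b b refl refl BR, of "p \<longleftrightarrow> c u = c v"] bip[OF a uv(2) refl 1(2) AR]])
              (use eC DAB disj in auto)
        next
          case 2
          thus ?thesis using reach_mono[OF odd[OF uv(1,2) 2 BR] DB, of 2] by simp
        next
          case 3
          show ?thesis
            \<comment> \<open>The new edge is crossed once, and the part in the odd component takes
              whichever parity is missing.\<close>
            by (rule reach_join[OF bip[OF uv(1) a 3(1) refl AR]
                  odd[OF b uv(2) refl 3(2) BR, of "p \<longleftrightarrow> c u \<noteq> c a"]])
              (use eC DAB disj in auto)
        next
          case 4
          show ?thesis
            by (rule reach_join[OF odd[OF uv(1) b 4(1) refl BR, of "p \<longleftrightarrow> c a \<noteq> c v"]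
                  bip[OF a uv(2) refl 4(2) AR]])
              (use eC DAB disj in auto)
        qed
      qed
      thus ?thesis by (intro finish[OF AR, of c]) auto
    qed
  qed
qed

lemma component_labelling_exists:
  fixes V :: "'a set"
  assumes "finite V" "finite E" "loop_graph V E" "even_walk_free E"
  shows "\<exists>(r :: 'a \<Rightarrow> 'a) R c. component_labelling V E r R c"
  using assms(2-4)
proof (induction E rule: finite_induct)
  case empty
  \<comment> \<open>Without edges every vertex is a bipartite component of its own:
    \<open>R = V\<close>, and the empty walk joins it to itself.\<close>
  have "reach 1 F u False u" for F and u :: 'a
    unfolding reach_def by (rule exI[of _ "[]"]) simp
  hence "component_labelling V {} id V (\<lambda>_. True)"
    using assms(1) by (simp add: component_labelling_def)
  thus ?case by blast
next
  case (insert e E)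
  have "loop_graph V E" using insert.prems(1) by (simp add: loop_graph_def)
  moreover have "even_walk_free E" using even_walk_free_mono[OF insert.prems(2)] by blast
  ultimately obtain r :: "'a \<Rightarrow> 'a" and R c where lab: "component_labelling V E r R c"
    using insert.IH by blast
  obtain u v where uv: "e = {u, v}" "u \<in> V" "v \<in> V"
    using insert.prems(1) by (auto simp: loop_graph_def)
  \<comment> \<open>The ends are swapped if necessary to meet the orientation hypothesis
    \<open>ba\<close> of the insertion lemma.\<close>
  obtain a b where ab: "e = {a, b}" "a \<in> V" "b \<in> V" "r b \<in> R \<Longrightarrow> r a \<in> R"
  proof (cases "r v \<in> R \<longrightarrow> r u \<in> R")
    case True
    thus ?thesis using that[of u v] uv by blast
  next
    case False
    thus ?thesis using that[of v u] uv by blast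
  qed
  show ?case
    using component_labelling_insert[OF lab _ _ ab(2,3) insert.hyps(1) ab(4)]
      insert.prems(2) insert.hyps(2) ab(1) by blast
qed

section \<open>The bound for finite and for infinite vertex sets\<close>

lemma card_le_if_even_walk_free:
  assumes "finite V" "loop_graph V E" "even_walk_free E"
  shows "finite E \<and> card E \<le> card V"
proof -
  have "E \<subseteq> Pow V" using assms(2) by (auto simp: loop_graph_def)
  hence "finite E" using assms(1) by (meson finite_Pow_iff finite_subset)
  thus ?thesis using component_labelling_exists[OF assms(1) _ assms(2,3)]
    by (auto simp: component_labelling_def)
qed

lemma loop_graph_lepoll_infinite:
  assumes "infinite V" "loop_graph V E"
  shows "E \<lesssim> V"
proof -
  have "E \<subseteq> (\<lambda>(u, v). {u, v}) ` (V \<times> V)" using assms(2) by (auto simp: loop_graph_def)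
  hence "E \<lesssim> V \<times> V"
    by (meson image_lepoll lepoll_trans subset_imp_lepoll)
  also have "V \<times> V \<lesssim> V"
    using card_of_Times_same_infinite[OF assms(1)]
    by (simp add: lepoll_def card_of_ordLeq ordIso_iff_ordLeq)
  finally show ?thesis .
qed

theorem lemma2p3:
  fixes V :: "'a set" and E :: "'a set set"
  assumes "loop_graph V E"
    and "\<nexists>vs es. nontrivial_even_closed_walk V E vs es"
  shows "E \<lesssim> V \<and> (finite V \<longrightarrow> card E \<le> card V)"
proof (cases "finite V")
  case True
  have "finite E \<and> card E \<le> card V"
    using card_le_if_even_walk_free[OF True assms(1)]
      even_walk_free_if_no_even_closed_walk[OF assms] by blast
  thus ?thesis using True by (simp add: lepoll_iff_card_le)
next
  case False
  thus ?thesis using loop_graph_lepoll_infinite assms(1) by blast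
qed

end
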